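(* Let $n\ge1$ and $\max\{0,k-n\}\le r\le k/2\le n$. The Lefschetz decomposition of $\tau_{k,r}\in\mathrm{Val}^{U(n)}$ is given by $$\tau_{k,r}=\frac1{(k-2r)!}\sum_{i=0}^r\binom{n-2i}{r-i}\frac{(2n-2i-2r)!}{(2n-4i)!}\,\pi_{k,i},$$ where terms with $k>2n-2i$ are understood to be zero.
   Context: $\omega_k$ is the volume of the unit ball of $\mathbb R^k$. $\mathrm{Val}^{U(n)}$ is the space of translation-invariant, $U(n)$-invariant, continuous (complex-valued) valuations on the convex bodies of $\mathbb C^n$. Basis $\mu_{k,q}$: let $(x_i,y_i,\xi_i,\eta_i)_{i=1}^n$ be the canonical real coordinates on $T\mathbb C^n=\mathbb C^n\times\mathbb C^n$ ($z_i=x_i+\sqrt{-1}y_i$, $\zeta_i=\xi_i+\sqrt{-1}\eta_i$), and on the unit sphere bundle $S\mathbb C^n$ consider $\beta=\sum(\xi_idy_i-\eta_idx_i)$, $\gamma=\sum(\xi_id\eta_i-\eta_id\xi_i)$, $\theta_0=\sum d\xi_i\wedge d\eta_i$, $\theta_1=\sum(dx_i\wedge d\eta_i-dy_i\wedge d\xi_i)$, $\theta_2=\sum dx_i\wedge dy_i$. With $c_{n,k,q}=\frac1{q!\,(n-k+q)!\,(k-2q)!\,\omega_{2n-k}}$ put $\beta_{k,q}=c_{n,k,q}\,\beta\wedge\theta_0^{n-k+q}\wedge\theta_1^{k-2q-1}\wedge\theta_2^q$ and $\gamma_{k,q}=\frac{c_{n,k,q}}2\gamma\wedge\theta_0^{n-k+q-1}\wedge\theta_1^{k-2q}\wedge\theta_2^q$.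 For $\max\{0,k-n\}\le q\le k/2\le n$: $\mu_{k,q}(A)=\int_{N(A)}\beta_{k,q}$ if $k>2q$; $\mu_{2q,q}(A)=\int_{N(A)}\gamma_{2q,q}$ if $q<n$; $\mu_{2n,n}=\mathrm{vol}$. Here $N(A)\subset S\mathbb C^n$ is the normal cycle of the convex body $A$ (outward unit normals, oriented so that $\int_{N(A)}\beta\wedge\theta_2^{n-1}/(n-1)!$ is the area of $\partial A$ for $A$ with nonempty interior and smooth boundary). These form a basis of $\mathrm{Val}^{U(n)}$; set $\mu_{k,q}=0$ for all other indices. Tasaki valuations: $\tau_{k,q}=\sum_{i=q}^{\lfloor k/2\rfloor}\binom iq\mu_{k,i}$ for $0\le q\le k/2$. For $0\le2r\le n$ and $2r\le k\le2n-2r$, $$\pi_{k,r}=(-1)^r(2n-4r+1)!!\sum_{i=0}^r(-1)^i\frac{(k-2i)!}{(2r-2i)!}\frac{(2r-2i-1)!!}{(2n-2r-2i+1)!!}\tau_{k,i},$$ with $(-1)!!=1$; these form a basis of $\mathrm{Val}^{U(n)}$, with $\pi_{k,r}=L^{k-2r}\pi_{2r,r}$ and $\Lambda\pi_{2r,r}=0$ for the operators $\Lambda,L$ that give $\mathrm{Val}^{U(n)}$ its $\mathfrak{sl}_2$-module structure (for $\nu$ homogeneous of degree $k$: $\Lambda\nu=\frac{\omega_{2n-k}}{\omega_{2n-k+1}}\frac d{dt}|_{t=0}\nu(\cdot+t\mathbb B^{2n})$, $L\nu=\frac{2\omega_k}{\omega_{k+1}}\mu_1\cdot\nu$ with the Alesker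 product and $\mu_1$ the first intrinsic volume). "Lefschetz decomposition" means the expansion in the basis $\{\pi_{k,i}\}$. *)

theory Defs
  imports "HOL-Analysis.Analysis" "HOL-Combinatorics.Permutations"
begin

section \<open>Exterior forms\<close>

text \<open>
  A form of degree p on a real vector space is represented by a function of a sequence of
  vectors that only depends on the first p entries.  Degrees are explicit arguments of
  the wedge product, which is normalised so that
  (\<alpha> \<and> \<beta>)(u, v) = \<alpha>(u) \<beta>(v) - \<alpha>(v) \<beta>(u) for 1-forms.
\<close>

type_synonym 'v form = "(nat \<Rightarrow> 'v) \<Rightarrow> real"

definition wedge :: "nat \<Rightarrow> nat \<Rightarrow> 'v form \<Rightarrow> 'v form \<Rightarrow> 'v form" where
  "wedge p q \<alpha> \<beta> v =
     (\<Sum>\<sigma> | \<sigma> permutes {..<p + q}.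
        of_int (sign \<sigma>) * \<alpha> (\<lambda>i. v (\<sigma> i)) * \<beta> (\<lambda>i. v (\<sigma> (p + i)))) / (fact p * fact q)"

primrec wedge_pow :: "'v form \<Rightarrow> nat \<Rightarrow> 'v form" \<comment> \<open>powers of a 2-form\<close> where
  "wedge_pow \<alpha> 0 = (\<lambda>_. 1)"
| "wedge_pow \<alpha> (Suc m) = wedge 2 (2 * m) \<alpha> (wedge_pow \<alpha> m)"


section \<open>The invariant forms on the sphere bundle\<close>

text \<open>
  The tangent bundle of complex n-space is the product of two copies of it, with
  n = \<open>CARD('n)\<close>; its points and its tangent vectors are both pairs.  Forms on the sphere
  bundle are given by their extensions to the tangent bundle.
\<close>

type_synonym 'n tc = "(complex ^ 'n) \<times> (complex ^ 'n)"

definition dx :: "'n::finite \<Rightarrow> 'n tc form" where "dx i v = Re (fst (v 0) $ i)"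
definition dy :: "'n::finite \<Rightarrow> 'n tc form" where "dy i v = Im (fst (v 0) $ i)"
definition d\<xi> :: "'n::finite \<Rightarrow> 'n tc form" where "d\<xi> i v = Re (snd (v 0) $ i)"
definition d\<eta> :: "'n::finite \<Rightarrow> 'n tc form" where "d\<eta> i v = Im (snd (v 0) $ i)"

definition beta_form :: "'n::finite tc \<Rightarrow> 'n tc form" where
  "beta_form P v = (\<Sum>i\<in>UNIV. Re (snd P $ i) * dy i v - Im (snd P $ i) * dx i v)"

definition gamma_form :: "'n::finite tc \<Rightarrow> 'n tc form" where
  "gamma_form P v = (\<Sum>i\<in>UNIV. Re (snd P $ i) * d\<eta> i v - Im (snd P $ i) * d\<xi> i v)"

definition theta0 :: "'n::finite tc form" where
  "theta0 v = (\<Sum>i\<in>UNIV. wedge 1 1 (d\<xi> i) (d\<eta> i) v)"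

definition theta1 :: "'n::finite tc form" where
  "theta1 v = (\<Sum>i\<in>UNIV. wedge 1 1 (dx i) (d\<eta> i) v - wedge 1 1 (dy i) (d\<xi> i) v)"

definition theta2 :: "'n::finite tc form" where
  "theta2 v = (\<Sum>i\<in>UNIV. wedge 1 1 (dx i) (dy i) v)"

definition wedge_thetas :: "'n::finite tc form \<Rightarrow> nat \<Rightarrow> nat \<Rightarrow> nat \<Rightarrow> 'n tc form" where
  "wedge_thetas \<alpha> a b c =
     wedge 1 (2 * (a + b + c)) \<alpha>
       (wedge (2 * a) (2 * (b + c)) (wedge_pow theta0 a)
         (wedge (2 * b) (2 * c) (wedge_pow theta1 b) (wedge_pow theta2 c)))"

definition c_coeff :: "nat \<Rightarrow> nat \<Rightarrow> nat \<Rightarrow> real" where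
  "c_coeff n k q =
     1 / (fact q * fact (n + q - k) * fact (k - 2 * q) * unit_ball_vol (real (2 * n - k)))"

text \<open>Only used for \<open>k \<le> n + q\<close>, \<open>2 * q < k\<close>, so that no subtraction truncates.\<close>
definition beta_kq :: "nat \<Rightarrow> nat \<Rightarrow> 'n::finite tc \<Rightarrow> 'n tc form" where
  "beta_kq k q P v = c_coeff CARD('n) k q *
     wedge_thetas (beta_form P) (CARD('n) + q - k) (k - 2 * q - 1) q v"

text \<open>Only used for \<open>k = 2 * q\<close>, \<open>q < n\<close>.\<close>
definition gamma_kq :: "nat \<Rightarrow> nat \<Rightarrow> 'n::finite tc \<Rightarrow> 'n tc form" where
  "gamma_kq k q P v = c_coeff CARD('n) k q / 2 *
     wedge_thetas (gamma_form P) (CARD('n) + q - k - 1) (k - 2 * q) q v"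


section \<open>Convex bodies and integration over the normal cycle\<close>

definition convex_body :: "'a::euclidean_space set \<Rightarrow> bool" where
  "convex_body A \<longleftrightarrow> compact A \<and> convex A \<and> A \<noteq> {}"

definition normal_cycle :: "'a::euclidean_space set \<Rightarrow> ('a \<times> 'a) set" where
  "normal_cycle A = {(x, u). x \<in> A \<and> norm u = 1 \<and> (\<forall>y\<in>A. inner u (y - x) \<le> 0)}"

definition foot_normal :: "'a::euclidean_space set \<Rightarrow> 'a \<Rightarrow> 'a \<times> 'a" where
  "foot_normal A z = (closest_point A z, (z - closest_point A z) /\<^sub>R infdist z A)"

text \<open>Every parallel hypersurface of a convex body parametrises its normal cycle.\<close>
lemma bij_betw_foot_normal:
  fixes A :: "'a::euclidean_space set"
  assumes A: "convex_body A" and t: "t > 0"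
  shows "bij_betw (foot_normal A) {z. infdist z A = t} (normal_cycle A)"
proof -
  have cl: "closed A" and cv: "convex A" and ne: "A \<noteq> {}"
    using A by (auto simp: convex_body_def compact_imp_closed)
  have dst: "dist z (closest_point A z) = infdist z A" for z
  proof (rule antisym)
    show "dist z (closest_point A z) \<le> infdist z A"
      unfolding infdist_notempty[OF ne]
      by (rule cINF_greatest[OF ne]) (rule closest_point_le[OF cl])
    show "infdist z A \<le> dist z (closest_point A z)"
      by (rule infdist_le) (rule closest_point_in_set[OF cl ne])
  qed
  have cp: "closest_point A (x + t *\<^sub>R u) = x" if "(x, u) \<in> normal_cycle A" for x u
  proof -
    have xA: "x \<in> A" and u: "\<forall>y\<in>A. inner u (y - x) \<le> 0"
      using that by (auto simp: normal_cycle_def)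
    have "dist (x + t *\<^sub>R u) x \<le> dist (x + t *\<^sub>R u) y" if "y \<in> A" for y
    proof -
      have "inner (t *\<^sub>R u) (y - x) \<le> 0"
        using u that t by (simp add: mult_nonneg_nonpos)
      moreover have "(norm (t *\<^sub>R u - (y - x)))\<^sup>2 =
          (norm (t *\<^sub>R u))\<^sup>2 - 2 * inner (t *\<^sub>R u) (y - x) + (norm (y - x))\<^sup>2"
        unfolding power2_norm_eq_inner
        by (simp only: inner_diff_left[of "t *\<^sub>R u"] inner_diff_right[of _ "t *\<^sub>R u"]
            inner_commute[of "y - x" "t *\<^sub>R u"])
      ultimately have "(norm (t *\<^sub>R u))\<^sup>2 \<le> (norm (t *\<^sub>R u - (y - x)))\<^sup>2"
        using zero_le_power2[of "norm (y - x)"] by linarith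
      then have "norm (t *\<^sub>R u) \<le> norm (t *\<^sub>R u - (y - x))"
        by (rule power2_le_imp_le) simp
      then show ?thesis by (simp add: dist_norm algebra_simps)
    qed
    then show ?thesis using closest_point_unique[OF cv cl xA] by metis
  qed
  show ?thesis
  proof (rule bij_betw_byWitness[where f' = "\<lambda>(x, u). x + t *\<^sub>R u"])
    show "\<forall>z\<in>{z. infdist z A = t}. (case foot_normal A z of (x, u) \<Rightarrow> x + t *\<^sub>R u) = z"
      using t by (auto simp: foot_normal_def)
    show "\<forall>w\<in>normal_cycle A. foot_normal A (case w of (x, u) \<Rightarrow> x + t *\<^sub>R u) = w"
    proof clarify
      fix x u assume xu: "(x, u) \<in> normal_cycle A"
      have "infdist (x + t *\<^sub>R u) A = t"
        using dst[of "x + t *\<^sub>R u"] cp[OF xu] xu t by (simp add: dist_norm normal_cycle_def)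
      then show "foot_normal A (x + t *\<^sub>R u) = (x, u)"
        using cp[OF xu] t by (simp add: foot_normal_def)
    qed
    show "foot_normal A ` {z. infdist z A = t} \<subseteq> normal_cycle A"
    proof (rule image_subsetI)
      fix z assume "z \<in> {z. infdist z A = t}"
      then have zt: "infdist z A = t" by simp
      have "inner (z - closest_point A z) (y - closest_point A z) \<le> 0" if "y \<in> A" for y
        by (rule closest_point_dot[OF cv cl that])
      moreover have "norm (z - closest_point A z) = infdist z A"
        using dst[of z] by (simp add: dist_norm)
      ultimately show "foot_normal A z \<in> normal_cycle A"
        using t zt closest_point_in_set[OF cl ne]
        by (auto simp: foot_normal_def normal_cycle_def divide_simps mult_nonneg_nonpos)
    qed
    show "(\<lambda>(x, u). x + t *\<^sub>R u) ` normal_cycle A \<subseteq> {z. infdist z A = t}"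
    proof -
      have "infdist (x + t *\<^sub>R u) A = t" if xu: "(x, u) \<in> normal_cycle A" for x u
        using dst[of "x + t *\<^sub>R u"] cp[OF xu] xu t by (simp add: dist_norm normal_cycle_def)
      then show ?thesis by auto
    qed
  qed
qed

text \<open>
  A real orthonormal basis of complex n-space that is positive for the standard orientation
  (each coordinate vector is immediately followed by its multiple by the imaginary unit).  The
  choice of the enumeration of the coordinates does not affect the orientation.
\<close>
definition real_frame :: "nat \<Rightarrow> complex ^ 'n::finite" where
  "real_frame j =
     axis ((SOME e. bij_betw e {..<CARD('n)} (UNIV :: 'n set)) (j div 2))
       (if even j then 1 else \<i>)"

text \<open>
  Integral of a form \<phi> of degree 2n - 1 over \<open>normal_cycle A\<close>.  Let F = \<open>foot_normal A\<close> and let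
  \<rho> be the distance to A.  F is locally Lipschitz off A and restricts, by the lemma above,
  to a parametrisation of the normal cycle by each hypersurface \<open>\<rho> = t\<close>, t > 0.  Hence, the
  shell being fibred by these hypersurfaces for 0 < t < 1,
    \<integral>_shell d\<rho> \<and> F^* \<phi> = \<integral>_0^1 (\<integral>_{\<rho> = t} F^* \<phi>) dt = \<integral>_{N(A)} \<phi>.
  The derivatives exist almost everywhere by Rademacher's theorem.  Orienting the shell in the
  standard way means that the hypersurfaces carry the orientation with the outward normal
  first; as \<beta> restricts to the contraction of \<theta>_2 with the outward normal, the integral of
  \<beta> \<and> \<theta>_2^(n-1) / (n-1)! is then the surface area of a smooth body.
\<close>
definition normal_cycle_integral ::
    "(complex ^ 'n::finite) set \<Rightarrow> ('n tc \<Rightarrow> 'n tc form) \<Rightarrow> real" where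
  "normal_cycle_integral A \<phi> =
     set_lebesgue_integral lebesgue {z. 0 < infdist z A \<and> infdist z A < 1}
       (\<lambda>z. wedge 1 (2 * CARD('n) - 1)
              (\<lambda>v. frechet_derivative (\<lambda>w. infdist w A) (at z) (v 0))
              (\<lambda>v. \<phi> (foot_normal A z)
                     (\<lambda>j. frechet_derivative (foot_normal A) (at z) (v j)))
              real_frame)"


section \<open>Valuations\<close>

definition mu :: "nat \<Rightarrow> nat \<Rightarrow> (complex ^ 'n::finite) set \<Rightarrow> complex" where
  "mu k q A =
     (if k \<le> CARD('n) + q \<and> 2 * q \<le> k \<and> k \<le> 2 * CARD('n) then
        complex_of_real
          (if 2 * q < k then normal_cycle_integral A (beta_kq k q)
           else if q < CARD('n) then normal_cycle_integral A (gamma_kq k q)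
           else measure lebesgue A)
      else 0)"

definition tau :: "nat \<Rightarrow> nat \<Rightarrow> (complex ^ 'n::finite) set \<Rightarrow> complex" where
  "tau k q A = (\<Sum>i = q..k div 2. of_nat (i choose q) * mu k i A)"

fun dfact :: "nat \<Rightarrow> nat" where
  "dfact 0 = 1"
| "dfact (Suc 0) = 1"
| "dfact (Suc (Suc m)) = Suc (Suc m) * dfact m"

text \<open>
  For \<open>i = r\<close> the truncated \<open>2 * r - 2 * i - 1\<close> is 0, and \<open>dfact 0 = 1\<close> is the intended value
  of (-1)!!.  The definition is meaningful for \<open>2 * r \<le> n\<close> and \<open>2 * r \<le> k \<le> 2 * n - 2 * r\<close>.
\<close>
definition pi_val :: "nat \<Rightarrow> nat \<Rightarrow> (complex ^ 'n::finite) set \<Rightarrow> complex" where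
  "pi_val k r A =
     (-1) ^ r * of_nat (dfact (2 * CARD('n) + 1 - 4 * r)) *
     (\<Sum>i = 0..r. (-1) ^ i
        * (fact (k - 2 * i) / fact (2 * r - 2 * i))
        * (of_nat (dfact (2 * r - 2 * i - 1)) / of_nat (dfact (2 * CARD('n) + 1 - 2 * r - 2 * i)))
        * tau k i A)"

end

theory Submission
  imports Defs
begin

text \<open>
  Everything takes place in the span of the \<open>\<mu>\<^bsub>k,m\<^esub>\<close> for fixed k.  Write n for the complex
  dimension and put \<open>w\<^sub>j = (-2)^j (k - 2j)! \<tau>\<^bsub>k,j\<^esub>\<close>.  Up to a nonzero factor depending only on n
  and i, \<open>\<pi>\<^bsub>k,i\<^esub>\<close> is the sum
    \<open>p\<^sub>i = \<Sum>j\<le>i. w\<^sub>j / ((i - j)! (2n - 2i - 2j + 1)!!)\<close>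
  (\<open>pi_val_hahn_transform\<close>).  This triangular system is solved by
    \<open>(-1)^r w\<^sub>r = \<Sum>i\<le>r. (-1)^i (2n - 4i + 1) (2n - 2i - 2r - 1)!! / (r - i)! p\<^sub>i\<close>
  (\<open>hahn_inversion\<close>), a telescoping identity of the kind underlying Bailey's inverse pairs.
  The coefficients turn into those of the Lefschetz decomposition by writing factorials of
  even numbers as products of factorials and odd double factorials (\<open>lefschetz_coefficient\<close>).

  The inversion produces all terms \<open>i \<le> r\<close>, including those with \<open>k > 2n - 2i\<close>, for which
  \<open>\<pi>\<^bsub>k,i\<^esub>\<close> is undefined.  For this the odd double factorial is continued to negative odd
  numbers, so that the inversion holds without restriction on n.  The extra \<open>p\<^sub>i\<close> are then
  zero as valuations (\<open>hahn_transform_tau_vanishes\<close>): the coefficient of \<open>\<mu>\<^bsub>k,m\<^esub>\<close> in \<open>p\<^sub>i\<close> is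
  a multiple of the Hahn polynomial
    \<open>3F2(-i, i - n - 1/2, -m; -k/2, (1 - k)/2; 1)\<close>,
  and \<open>\<mu>\<^bsub>k,m\<^esub>\<close> is nonzero only for \<open>max {0, k - n} \<le> m \<le> k/2\<close>, the support of the weight with
  respect to which these polynomials are orthogonal.  If \<open>k > 2n - 2i\<close>, the degree i is at
  least the number of points of the support, and the polynomial vanishes at all of them.
  Directly, the coefficient is an i-th finite difference of a polynomial of degree below i.
\<close>

section \<open>Odd double factorials at all integers\<close>

text \<open>
  The function \<open>(2a - 1)!!\<close> of an integer a, continued to negative a by the recurrence
  \<open>(2a + 1)!! = (2a + 1) (2a - 1)!!\<close>.  The factor \<open>2a + 1\<close> is never 0, so the
  continuation is everywhere defined and nonzero.
\<close>

definition odd_dfact :: "int \<Rightarrow> 'a::field_char_0" where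
  "odd_dfact a = (if 0 \<le> a then \<Prod>t<nat a. of_nat (2 * t + 1)
     else inverse (\<Prod>t<nat (- a). - of_nat (2 * t + 1)))"

lemma odd_ne_0: "2 * of_int a + 1 \<noteq> (0::'a::field_char_0)"
proof
  assume "2 * of_int a + 1 = (0::'a)"
  then have "of_int (2 * a + 1) = (0::'a)" by simp
  then show False unfolding of_int_eq_0_iff by presburger
qed

lemma odd_dfact_step:
  "odd_dfact (a + 1) = (2 * of_int a + 1) * (odd_dfact a :: 'a::field_char_0)"
proof (cases "0 \<le> a")
  case True
  then have "nat (a + 1) = Suc (nat a)" by simp
  with True show ?thesis by (simp add: odd_dfact_def algebra_simps)
next
  case False
  then obtain b where b: "a = - int (Suc b)"
    using negD[of a] by auto
  have neg: "odd_dfact (- int c) = inverse (\<Prod>t<c. - of_nat (2 * t + 1) :: 'a)" for c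
    by (cases "c = 0") (simp_all add: odd_dfact_def)
  have ne: "of_nat (2 * b + 1) \<noteq> (0::'a)" unfolding of_nat_eq_0_iff by simp
  have e: "2 * of_int a + 1 = (- of_nat (2 * b + 1) :: 'a)" by (simp add: b)
  have "odd_dfact (a + 1) = inverse (\<Prod>t<b. - of_nat (2 * t + 1) :: 'a)"
    using neg[of b] by (simp add: b)
  moreover have "odd_dfact a = inverse ((\<Prod>t<b. - of_nat (2 * t + 1) :: 'a) * - of_nat (2 * b + 1))"
    using neg[of "Suc b"] unfolding b by (simp only: prod.lessThan_Suc)
  moreover have "inverse P = y * inverse (P * y)" if "y \<noteq> 0" for P y :: 'a
    using that by simp
  ultimately show ?thesis using ne unfolding e by (metis neg_equal_0_iff_equal)
qed

lemma odd_dfact_ne_0: "odd_dfact a \<noteq> (0::'a::field_char_0)"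
proof -
  have "(1 + 2 * of_nat t :: 'a) \<noteq> 0" for t
    using odd_ne_0[of "int t"] by (simp add: add.commute)
  moreover from this have "- 1 \<noteq> (2 * of_nat t :: 'a)" for t
    by (metis add.right_inverse)
  ultimately show ?thesis by (auto simp: odd_dfact_def)
qed

lemma odd_dfact_add:
  "odd_dfact (a + int d) = odd_dfact a * (\<Prod>t<d. 2 * (of_int a + of_nat t) + 1 :: 'a::field_char_0)"
proof (induction d)
  case (Suc d)
  have "odd_dfact (a + int (Suc d)) = odd_dfact ((a + int d) + 1)" by (simp add: algebra_simps)
  also have "\<dots> = (2 * of_int (a + int d) + 1) * (odd_dfact (a + int d) :: 'a)"
    by (rule odd_dfact_step)
  finally show ?case by (simp add: Suc.IH mult_ac)
qed simp

lemma of_nat_dfact_odd: "of_nat (dfact (2 * a - 1)) = (odd_dfact (int a) :: 'a::field_char_0)"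
proof (induction a rule: less_induct)
  case (less a)
  show ?case
  proof (cases "a < 2")
    case True
    then have "a = 0 \<or> a = 1" by auto
    then show ?thesis by (auto simp: odd_dfact_def)
  next
    case False
    then obtain b where b: "a = Suc (Suc b)" by (metis add_2_eq_Suc le_Suc_ex not_less)
    have "2 * a - 1 = Suc (Suc (2 * Suc b - 1))" by (simp add: b)
    moreover have "odd_dfact (int a) = (2 * of_nat (Suc b) + 1) * (odd_dfact (int (Suc b)) :: 'a)"
      using odd_dfact_step[of "int (Suc b)"] by (simp add: b algebra_simps)
    ultimately show ?thesis using less[of "Suc b"] b by (simp add: algebra_simps)
  qed
qed

lemma fact_split_odd:
  "fact (2 * a) = 2 ^ a * fact a * (odd_dfact (int a) :: 'a::field_char_0)"
  "fact (2 * a + 1) = 2 ^ a * fact a * (odd_dfact (int a + 1) :: 'a::field_char_0)"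
proof -
  show E: "fact (2 * a) = 2 ^ a * fact a * (odd_dfact (int a) :: 'a::field_char_0)" for a
  proof (induction a)
    case (Suc a)
    have "odd_dfact (int (Suc a)) = (2 * of_nat a + 1) * (odd_dfact (int a) :: 'a)"
      using odd_dfact_step[of "int a"] by (simp add: algebra_simps)
    moreover have "fact (2 * Suc a) = (2 * of_nat a + 2) * ((2 * of_nat a + 1) * (fact (2 * a) :: 'a))"
      by (simp add: algebra_simps)
    ultimately show ?case unfolding Suc.IH by (simp only: fact_Suc power_Suc) (simp add: algebra_simps)
  qed (simp add: odd_dfact_def)
  have "fact (2 * a + 1) = (2 * of_nat a + 1) * (fact (2 * a) :: 'a)" by simp
  then show "fact (2 * a + 1) = 2 ^ a * fact a * (odd_dfact (int a + 1) :: 'a)"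
    unfolding E[of a] odd_dfact_step by (simp only: of_int_of_nat_eq mult_ac)
qed

text \<open>
  For even k this is the splitting of an even factorial, for odd k that of an odd one; with
  the floor and the ceiling of \<open>k/2\<close> both read the same, which avoids a case distinction below.
\<close>

lemma fact_split_floor:
  assumes "j \<le> k div 2"
  shows "fact (k - 2 * j) =
    2 ^ (k div 2 - j) * fact (k div 2 - j) * (odd_dfact (int (k - k div 2) - int j) :: 'a::field_char_0)"
proof (cases "even k")
  case True
  then have "k - 2 * j = 2 * (k div 2 - j)" "int (k - k div 2) - int j = int (k div 2 - j)"
    using assms by auto
  then show ?thesis by (simp add: fact_split_odd(1))
next
  case False
  then have "k - 2 * j = 2 * (k div 2 - j) + 1" "int (k - k div 2) - int j = int (k div 2 - j) + 1"
    using assms odd_two_times_div_two_succ[OF False] by linarith+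
  then show ?thesis by (simp only: fact_split_odd(2))
qed

section \<open>Finite differences of polynomials\<close>

text \<open>
  The sum is, up to sign, the i-th finite difference of p at 0.  For \<open>p = c + x q(x)\<close> the
  absorption \<open>j (i choose j) = i (i - 1 choose j - 1)\<close> reduces it to the sum of order
  \<open>i - 1\<close> for \<open>q(x + 1)\<close>.
\<close>

lemma alternating_binomial_sum_poly:
  fixes p :: "'a::field_char_0 poly"
  assumes "degree p < i"
  shows "(\<Sum>j\<le>i. (-1) ^ j * of_nat (i choose j) * poly p (of_nat j)) = 0"
  using assms
proof (induction i arbitrary: p)
  case (Suc i)
  obtain c q where p: "p = pCons c q" by (cases p)
  have const: "(\<Sum>j\<le>Suc i. (-1) ^ j * of_nat (Suc i choose j)) = (0::'a)"
    using choose_alternating_sum[of "Suc i"] by simp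
  have ab: "of_nat (Suc j) * of_nat (Suc i choose Suc j) = (of_nat (Suc i) * of_nat (i choose j) :: 'a)" for j
    using Suc_times_binomial[of j i] by (metis of_nat_mult)
  have "(\<Sum>j\<le>Suc i. (-1) ^ j * of_nat (Suc i choose j) * poly p (of_nat j)) =
     c * (\<Sum>j\<le>Suc i. (-1) ^ j * of_nat (Suc i choose j))
     + (\<Sum>j\<le>Suc i. (-1) ^ j * (of_nat j * of_nat (Suc i choose j)) * poly q (of_nat j))"
    by (simp add: p sum.distrib sum_distrib_left algebra_simps del: sum.atMost_Suc binomial_Suc_Suc)
  also have "(\<Sum>j\<le>Suc i. (-1) ^ j * (of_nat j * of_nat (Suc i choose j)) * poly q (of_nat j)) =
     (\<Sum>j\<le>i. (-1) ^ Suc j * (of_nat (Suc j) * of_nat (Suc i choose Suc j)) * poly q (of_nat (Suc j)))"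
    by (subst sum.atMost_Suc_shift) (simp del: binomial_Suc_Suc)
  also have "\<dots> = - of_nat (Suc i) *
      (\<Sum>j\<le>i. (-1) ^ j * of_nat (i choose j) * poly (pcompose q [:1, 1:]) (of_nat j))"
    unfolding ab sum_distrib_left
    by (intro sum.cong refl) (simp add: poly_pcompose algebra_simps)
  also have "\<dots> = 0"
  proof (cases "q = 0")
    case False
    then have "degree (pcompose q [:1, 1:]) < i"
      using Suc.prems by (simp add: p degree_pcompose)
    then show ?thesis by (simp add: Suc.IH)
  qed simp
  finally show ?case using const by simp
qed simp

text \<open>
  For fixed m and l the right-hand side is a polynomial in j of degree \<open>l - m\<close>; this covers
  the range \<open>m < j \<le> l\<close> too, where both sides vanish.
\<close>

lemma binomial_times_fact_pochhammer:
  assumes "m \<le> l" "j \<le> l"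
  shows "of_nat (m choose j) * fact (l - j) * fact j =
    fact m * pochhammer (of_nat m - of_nat j + 1 :: 'a::field_char_0) (l - m)"
proof (cases "j \<le> m")
  case True
  have "fact (l - j) = (fact (m - j) * pochhammer (1 + of_nat (m - j)) (l - m) :: 'a)"
    using pochhammer_product'[of "1::'a" "m - j" "l - m"] True assms
    by (simp add: pochhammer_fact)
  moreover have "of_nat (m choose j) * fact j * fact (m - j) = (fact m :: 'a)"
    using True by (simp add: binomial_fact)
  moreover have "1 + of_nat (m - j) = (of_nat m - of_nat j + 1 :: 'a)"
    using True by (simp add: of_nat_diff)
  ultimately show ?thesis by (simp add: mult_ac)
next
  case False
  then have "of_nat m - of_nat j + 1 = (- of_nat (j - m - 1) :: 'a)"
    by (simp add: of_nat_diff)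
  moreover have "j - m - 1 < l - m" using False assms by simp
  ultimately have "pochhammer (of_nat m - of_nat j + 1 :: 'a) (l - m) = 0"
    by (metis pochhammer_of_nat_eq_0_iff)
  then show ?thesis using False by simp
qed

section \<open>The inverse relation\<close>

text \<open>
  With \<open>N = r - j - 1\<close> and i replaced by \<open>p + j\<close>, the summand is up to a constant factor
  the difference \<open>G (p + 1) - G p\<close> of
    \<open>G p = (-1)^p (N choose p - 1) (2(n - i - r) + 1)!! / (2(n - i - j) + 1)!!\<close>,
  and G vanishes at both ends because the binomial coefficient does.
\<close>

lemma inverse_pair_orthogonality:
  fixes n :: int
  assumes "j < r"
  shows "(\<Sum>i = j..r. (-1) ^ i * of_int (2 * n - 4 * int i + 1) * odd_dfact (n - int i - int r) /
     (fact (r - i) * fact (i - j) * odd_dfact (n - int i - int j + 1))) = (0::'a::field_char_0)"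
proof -
  define N where "N = r - j - 1"
  have r: "r = j + Suc N" using assms by (simp add: N_def)
  let ?D = "odd_dfact :: int \<Rightarrow> 'a"
  define G where "G p = (case p of 0 \<Rightarrow> 0 | Suc p' \<Rightarrow> (-1) ^ p * of_nat (N choose p') *
     ?D (n - int (p + j) - int r + 1) / ?D (n - int (p + j) - int j + 1))" for p
  let ?T = "\<lambda>i. (-1) ^ i * of_int (2 * n - 4 * int i + 1) * ?D (n - int i - int r) /
     (fact (r - i) * fact (i - j) * ?D (n - int i - int j + 1))"
  have step: "?T (p + j) = (-1) ^ Suc j / fact (Suc N) * (G (Suc p) - G p)" if "p \<le> Suc N" for p
  proof -
    let ?a = "n - int (p + j) - int r" and ?b = "n - int (p + j) - int j"
    let ?A = "?D ?a" and ?B = "?D ?b"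
    have A: "?D (?a + 1) = (2 * of_int ?a + 1) * ?A" and B: "?D (?b + 1) = (2 * of_int ?b + 1) * ?B"
      by (rule odd_dfact_step)+
    have nz: "?B \<noteq> 0" "(2 * of_int ?b + 1 :: 'a) \<noteq> 0" by (rule odd_dfact_ne_0, rule odd_ne_0)
    have G1: "G (Suc p) = (-1) ^ Suc p * of_nat (N choose p) * ?A / ?B"
      by (simp add: G_def algebra_simps)
    have G0: "G p = (-1) ^ p * (of_nat p * of_nat (Suc N choose p) / of_nat (Suc N)) *
        ((2 * of_int ?a + 1) * ?A) / ((2 * of_int ?b + 1) * ?B)"
    proof (cases p)
      case (Suc p')
      have "of_nat (Suc p') * of_nat (Suc N choose Suc p') = (of_nat (Suc N) * of_nat (N choose p') :: 'a)"
        using Suc_times_binomial[of p' N] by (metis of_nat_mult)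
      then have "of_nat p * of_nat (Suc N choose p) / of_nat (Suc N) = (of_nat (N choose p') :: 'a)"
        unfolding Suc by (simp del: binomial_Suc_Suc of_nat_Suc)
      then show ?thesis unfolding G_def A[symmetric] B[symmetric] by (simp add: Suc)
    qed (simp add: G_def)
    have ch: "of_nat (N choose p) = (of_nat (Suc N - p) * of_nat (Suc N choose p) / of_nat (Suc N) :: 'a)"
    proof -
      have "(Suc N - p) * (Suc N choose p) = Suc N * (N choose p)"
        using binomial_absorb_comp[of "Suc N" p] by simp
      then have "of_nat (Suc N - p) * of_nat (Suc N choose p) = (of_nat (Suc N) * of_nat (N choose p) :: 'a)"
        by (metis of_nat_mult)
      then show ?thesis by (simp del: binomial_Suc_Suc of_nat_Suc of_nat_diff)
    qed
    have bin: "1 / (fact (Suc N - p) * fact p) = (of_nat (Suc N choose p) / fact (Suc N) :: 'a)"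
      using binomial_fact[OF that, where 'a = 'a] by (simp add: field_simps del: fact_Suc binomial_Suc_Suc)
    \<comment> \<open>The two factors in parentheses on the right are those by which the double factorials
      in G change from p to p + 1; this is what makes the sum telescope.\<close>
    have key: "of_nat (Suc N) * of_int (2 * n - 4 * int (p + j) + 1) =
       of_nat (Suc N - p) * (2 * of_int ?b + 1) + (of_nat p * (2 * of_int ?a + 1) :: 'a)"
      using that by (simp add: of_nat_diff r algebra_simps)
    have "?T (p + j) = (-1) ^ (p + j) * of_int (2 * n - 4 * int (p + j) + 1) * ?A / ?D (?b + 1)
        * (1 / (fact (Suc N - p) * fact p))"
      using that by (simp add: r)
    also have "\<dots> = (-1) ^ (p + j) * of_nat (Suc N choose p) / fact (Suc N) * ?A / ?B
       * (of_int (2 * n - 4 * int (p + j) + 1) / (2 * of_int ?b + 1))"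
      unfolding bin B by (simp only: times_divide_eq_left times_divide_eq_right divide_divide_eq_left mult_ac)
    also have "of_int (2 * n - 4 * int (p + j) + 1) / (2 * of_int ?b + 1 :: 'a) =
       (of_nat (Suc N - p) + of_nat p * (2 * of_int ?a + 1) / (2 * of_int ?b + 1)) / of_nat (Suc N)"
      using key nz by (simp add: divide_simps mult_ac del: of_nat_Suc of_int_diff of_int_add of_int_mult of_nat_diff)
    also have "(-1) ^ (p + j) * of_nat (Suc N choose p) / fact (Suc N) * ?A / ?B * \<dots> =
      (-1) ^ Suc j / fact (Suc N) * (G (Suc p) - G p)"
      unfolding G1 G0 ch by (simp add: power_add add_divide_distrib right_diff_distrib distrib_left mult_ac
         del: of_nat_Suc of_int_diff of_int_add of_int_mult of_nat_diff fact_Suc binomial_Suc_Suc)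
    finally show ?thesis .
  qed
  have "(\<Sum>i = j..r. ?T i) = (\<Sum>p = 0..Suc N. ?T (p + j))"
    using sum.shift_bounds_cl_nat_ivl[of ?T 0 j "Suc N"] by (simp add: r add.commute)
  also have "\<dots> = (\<Sum>p = 0..Suc N. (-1) ^ Suc j / fact (Suc N) * (G (Suc p) - G p))"
    by (intro sum.cong refl step) simp
  also have "\<dots> = (-1) ^ Suc j / fact (Suc N) * (G (Suc (Suc N)) - G 0)"
    by (simp only: sum_distrib_left[symmetric] sum_Suc_diff[of 0 "Suc (Suc N)"] sum_Suc_diff)
  also have "\<dots> = 0" by (simp add: G_def)
  finally show ?thesis .
qed

text \<open>
  For \<open>w j = (-2)^j (k - 2j)! (m choose j)\<close> and \<open>i \<le> k/2\<close> this is, as a function of m, a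
  multiple of the Hahn polynomial of degree i.
\<close>

definition hahn_transform :: "int \<Rightarrow> (nat \<Rightarrow> 'a) \<Rightarrow> nat \<Rightarrow> 'a::field_char_0" where
  "hahn_transform n w i = (\<Sum>j\<le>i. w j / (fact (i - j) * odd_dfact (n - int i - int j + 1)))"

text \<open>
  The composition of the two triangular matrices is the identity: entries off the diagonal
  vanish by \<open>inverse_pair_orthogonality\<close>.
\<close>

lemma hahn_inversion:
  "(\<Sum>i\<le>r. (-1) ^ i * of_int (2 * n - 4 * int i + 1) * odd_dfact (n - int i - int r) / fact (r - i)
     * hahn_transform n w i) = (-1) ^ r * (w r :: 'a::field_char_0)"
proof -
  let ?T = "\<lambda>j i. (-1) ^ i * of_int (2 * n - 4 * int i + 1) * odd_dfact (n - int i - int r) /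
     (fact (r - i) * fact (i - j) * odd_dfact (n - int i - int j + 1)) :: 'a"
  have "(\<Sum>i\<le>r. (-1) ^ i * of_int (2 * n - 4 * int i + 1) * odd_dfact (n - int i - int r) / fact (r - i)
     * hahn_transform n w i) = (\<Sum>i\<le>r. \<Sum>j\<le>i. w j * ?T j i)"
    unfolding hahn_transform_def sum_distrib_left
    by (intro sum.cong refl) (simp only: times_divide_eq_left times_divide_eq_right divide_divide_eq_left mult_ac)
  also have "\<dots> = (\<Sum>j\<le>r. \<Sum>i = j..r. w j * ?T j i)"
    unfolding sum.Sigma[OF finite_atMost ballI[OF finite_atMost]]
      sum.Sigma[OF finite_atMost ballI[OF finite_atLeastAtMost]]
    by (rule sum.reindex_bij_witness[where i = prod.swap and j = prod.swap]) auto
  also have "\<dots> = (\<Sum>j\<le>r. w j * (\<Sum>i = j..r. ?T j i))"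
    by (simp only: sum_distrib_left)
  also have "\<dots> = (\<Sum>j\<le>r. if j = r then (-1) ^ r * w r else 0)"
  proof (intro sum.cong refl)
    fix j assume "j \<in> {..r}"
    then consider "j < r" | "j = r" by force
    then show "w j * (\<Sum>i = j..r. ?T j i) = (if j = r then (-1) ^ r * w r else 0)"
    proof cases
      case 2
      have "odd_dfact (n - int r - int r + 1) =
         of_int (2 * n - 4 * int r + 1) * (odd_dfact (n - int r - int r) :: 'a)"
        by (subst odd_dfact_step) (simp add: algebra_simps)
      moreover have "odd_dfact (n - int r - int r + 1) \<noteq> (0::'a)" by (rule odd_dfact_ne_0)
      ultimately show ?thesis using 2 by (simp del: of_int_diff of_int_add of_int_mult)
    next
      case 1
      then show ?thesis by (simp only: inverse_pair_orthogonality) simp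
    qed
  qed
  finally show ?thesis by simp
qed

section \<open>Vanishing beyond the Lefschetz range\<close>

text \<open>
  Put \<open>l = \<lfloor>k/2\<rfloor>\<close> and \<open>h = \<lceil>k/2\<rceil>\<close>.  Splitting \<open>(k - 2j)!\<close> leaves two factors depending on j
  besides \<open>(-1)^j (i choose j)\<close>: the product \<open>(m choose j) (l - j)! j!\<close>, a polynomial in j
  of degree \<open>l - m\<close>, and the quotient of \<open>(2h - 2j - 1)!!\<close> by \<open>(2n - 2i - 2j + 1)!!\<close>.  The
  hypothesis \<open>2n < k + 2i\<close> makes the latter a polynomial, of degree \<open>h + i - n - 1\<close>.  The
  degrees add up to \<open>i - 1 - (n + m - k)\<close>, so \<open>k \<le> n + m\<close> makes the total less than i.
\<close>

lemma hahn_transform_vanishes: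
  fixes k n m i :: nat
  assumes "2 * n < k + 2 * i" "i \<le> k div 2" "m \<le> k div 2" "k \<le> n + m"
  shows "hahn_transform (int n) (\<lambda>j. (-2) ^ j * fact (k - 2 * j) * of_nat (m choose j)) i
    = (0::'a::field_char_0)"
proof -
  define l where "l = k div 2"
  define h where "h = k - l"
  define d where "d = h + i - n - 1"
  have hi: "n < h + i" using assms(1) unfolding h_def l_def by presburger
  define q :: "'a poly" where "q = (\<Prod>t<l - m. [:of_nat m + 1 + of_nat t, -1:]) *
     (\<Prod>t<d. [:2 * (of_int (int n - int i + 1) + of_nat t) + 1, -2:])"
  have "degree q \<le> (l - m) + d"
  proof -
    have "degree (\<Prod>t<l - m. [:of_nat m + 1 + of_nat t, -1::'a:]) \<le> (\<Sum>t<l - m. 1)"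
      by (rule order_trans[OF degree_prod_sum_le]) (auto intro: sum_mono)
    moreover have "degree (\<Prod>t<d. [:2 * (of_int (int n - int i + 1) + of_nat t) + 1, -2::'a:]) \<le> (\<Sum>t<d. 1)"
      by (rule order_trans[OF degree_prod_sum_le]) (auto intro: sum_mono)
    ultimately show ?thesis unfolding q_def
      by (intro order_trans[OF degree_mult_le] add_mono) simp_all
  qed
  moreover have "(l - m) + d < i"
    using hi assms(3,4) unfolding d_def h_def l_def by linarith
  ultimately have deg: "degree q < i" by linarith
  have summand: "(-2) ^ j * fact (k - 2 * j) * of_nat (m choose j) /
       (fact (i - j) * odd_dfact (int n - int i - int j + 1)) =
     2 ^ l * fact m / fact i * ((-1) ^ j * of_nat (i choose j) * poly q (of_nat j) :: 'a)"
    if "j \<le> i" for j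
  proof -
    have jl: "j \<le> l" using that assms(2) by (simp add: l_def)
    let ?b = "int n - int i - int j + 1"
    define P where "P = (\<Prod>t<d. 2 * (of_int ?b + of_nat t) + 1 :: 'a)"
    define R where "R = pochhammer (of_nat m - of_nat j + 1 :: 'a) (l - m)"
    have "int h - int j = ?b + int d" using hi by (simp add: d_def)
    then have D: "odd_dfact (int h - int j) = odd_dfact ?b * P"
      unfolding P_def by (metis odd_dfact_add)
    have q: "poly q (of_nat j) = R * P"
      unfolding q_def P_def R_def poly_mult poly_prod pochhammer_prod atLeast0LessThan
      by (intro arg_cong2[where f = "(*)"] prod.cong refl) (simp_all add: algebra_simps)
    have f: "fact (k - 2 * j) = 2 ^ (l - j) * fact (l - j) * (odd_dfact ?b * P)"
      using fact_split_floor[of j k, where 'a = 'a] jl D unfolding l_def h_def by simp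
    have c: "of_nat (m choose j) * fact (l - j) = fact m * R / (fact j :: 'a)"
      using binomial_times_fact_pochhammer[of m l j, where 'a = 'a] jl assms(3)
      unfolding l_def[symmetric] R_def by (simp add: field_simps)
    have e: "1 / (fact j * fact (i - j)) = (of_nat (i choose j) / fact i :: 'a)"
      using binomial_fact[OF that, where 'a = 'a] by (simp add: field_simps)
    have p: "(-2) ^ j * 2 ^ (l - j) = ((-1) ^ j * 2 ^ l :: 'a)"
    proof -
      have "(-2) ^ j = ((-1) ^ j * 2 ^ j :: 'a)" by (simp flip: power_mult_distrib)
      moreover have "2 ^ j * 2 ^ (l - j) = (2 ^ l :: 'a)" using jl by (simp flip: power_add)
      ultimately show ?thesis by (simp only: mult.assoc)
    qed
    have "(-2) ^ j * fact (k - 2 * j) * of_nat (m choose j) / (fact (i - j) * odd_dfact ?b)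
       = ((-2) ^ j * 2 ^ (l - j)) * (of_nat (m choose j) * fact (l - j)) * P / fact (i - j)
          * (odd_dfact ?b / odd_dfact ?b :: 'a)"
      unfolding f by (simp only: times_divide_eq_left times_divide_eq_right divide_divide_eq_left mult_ac)
    also have "\<dots> = (-1) ^ j * 2 ^ l * fact m * R * P * (1 / (fact j * fact (i - j)))"
      unfolding p c using odd_dfact_ne_0[of ?b, where 'a = 'a] by simp
    finally show ?thesis unfolding e q by (simp add: mult_ac)
  qed
  have "hahn_transform (int n) (\<lambda>j. (-2) ^ j * fact (k - 2 * j) * of_nat (m choose j)) i
     = 2 ^ l * fact m / fact i * (\<Sum>j\<le>i. (-1) ^ j * of_nat (i choose j) * poly q (of_nat j) :: 'a)"
    unfolding hahn_transform_def sum_distrib_left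
    by (intro sum.cong refl summand) simp
  then show ?thesis by (simp add: alternating_binomial_sum_poly[OF deg])
qed

section \<open>The Lefschetz decomposition\<close>

definition tau_weight :: "(complex ^ 'n::finite) set \<Rightarrow> nat \<Rightarrow> nat \<Rightarrow> complex" where
  "tau_weight A k j = (-2) ^ j * fact (k - 2 * j) * tau k j A"

text \<open>
  Expanded in the \<open>\<mu>\<^bsub>k,m\<^esub>\<close>, the coefficients with \<open>k \<le> n + m\<close> vanish by
  \<open>hahn_transform_vanishes\<close>, and for \<open>k > n + m\<close> the valuation \<open>\<mu>\<^bsub>k,m\<^esub>\<close> itself is zero.
\<close>

lemma hahn_transform_tau_vanishes:
  fixes A :: "(complex ^ 'n::finite) set"
  assumes "2 * CARD('n) < k + 2 * i" "i \<le> k div 2"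
  shows "hahn_transform (int CARD('n)) (tau_weight A k) i = 0"
proof -
  let ?n = "CARD('n)"
  have tau: "tau k j A = (\<Sum>m\<le>k div 2. of_nat (m choose j) * mu k m A)" for j
    unfolding tau_def by (rule sum.mono_neutral_left) auto
  have "hahn_transform (int ?n) (tau_weight A k) i = (\<Sum>m\<le>k div 2. mu k m A *
     hahn_transform (int ?n) (\<lambda>j. (-2) ^ j * fact (k - 2 * j) * of_nat (m choose j)) i)"
    unfolding hahn_transform_def tau_weight_def tau sum_distrib_left sum_divide_distrib
    by (subst sum.swap) (intro sum.cong refl, simp add: mult_ac)
  also have "\<dots> = 0"
  proof (intro sum.neutral ballI)
    fix m assume m: "m \<in> {..k div 2}"
    show "mu k m A *
       hahn_transform (int ?n) (\<lambda>j. (-2) ^ j * fact (k - 2 * j) * of_nat (m choose j)) i = 0"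
    proof (cases "k \<le> ?n + m")
      case True
      then show ?thesis
        using hahn_transform_vanishes[of ?n k i m, where 'a = complex] assms m by simp
    qed (simp add: mu_def)
  qed
  finally show ?thesis .
qed

text \<open>
  Each summand simplifies by \<open>(2a - 1)!! / (2a)! = 1 / (2^a a!)\<close> for \<open>a = i - j\<close>.  The
  condition \<open>2i \<le> n\<close> keeps the natural number subtractions from truncating.
\<close>

lemma pi_val_hahn_transform:
  fixes A :: "(complex ^ 'n::finite) set"
  assumes "2 * i \<le> CARD('n)"
  shows "pi_val k i A = (-1) ^ i * odd_dfact (int CARD('n) - 2 * int i + 1) / 2 ^ i *
    hahn_transform (int CARD('n)) (tau_weight A k) i"
proof -
  let ?n = "CARD('n)"
  have D: "complex_of_nat (dfact (2 * ?n + 1 - 4 * i)) = odd_dfact (int ?n - 2 * int i + 1)"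
  proof -
    have "2 * ?n + 1 - 4 * i = 2 * (?n - 2 * i + 1) - 1" using assms by simp
    moreover have "int (?n - 2 * i + 1) = int ?n - 2 * int i + 1" using assms by simp
    ultimately show ?thesis using of_nat_dfact_odd[of "?n - 2 * i + 1", where 'a = complex] by metis
  qed
  have T: "(-1) ^ j * (fact (k - 2 * j) / fact (2 * i - 2 * j)) *
      (of_nat (dfact (2 * i - 2 * j - 1)) / of_nat (dfact (2 * ?n + 1 - 2 * i - 2 * j))) * tau k j A
    = 1 / 2 ^ i * (tau_weight A k j / (fact (i - j) * odd_dfact (int ?n - int i - int j + 1)))"
    if "j \<le> i" for j
  proof -
    have "2 * ?n + 1 - 2 * i - 2 * j = 2 * (?n + 1 - i - j) - 1"
      and "int (?n + 1 - i - j) = int ?n - int i - int j + 1"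
      using assms that by linarith+
    then have 1: "complex_of_nat (dfact (2 * ?n + 1 - 2 * i - 2 * j)) = odd_dfact (int ?n - int i - int j + 1)"
      using of_nat_dfact_odd[of "?n + 1 - i - j", where 'a = complex] by simp
    have 2: "complex_of_nat (dfact (2 * i - 2 * j - 1)) = odd_dfact (int (i - j))"
      using of_nat_dfact_odd[of "i - j", where 'a = complex] by (simp add: diff_mult_distrib2)
    have 3: "fact (2 * i - 2 * j) = 2 ^ (i - j) * fact (i - j) * (odd_dfact (int (i - j)) :: complex)"
      using fact_split_odd(1)[of "i - j", where 'a = complex] by (simp add: diff_mult_distrib2)
    have 4: "(2::complex) ^ i = 2 ^ j * 2 ^ (i - j)" using that by (simp flip: power_add)
    have 5: "(-2::complex) ^ j = (-1) ^ j * 2 ^ j" by (simp flip: power_mult_distrib)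
    show ?thesis unfolding tau_weight_def 1 2 3 4 5
      using odd_dfact_ne_0[of "int (i - j)", where 'a = complex]
        odd_dfact_ne_0[of "int ?n - int i - int j + 1", where 'a = complex]
      by (simp add: field_simps)
  qed
  have "(\<Sum>j = 0..i. (-1) ^ j * (fact (k - 2 * j) / fact (2 * i - 2 * j)) *
      (of_nat (dfact (2 * i - 2 * j - 1)) / of_nat (dfact (2 * ?n + 1 - 2 * i - 2 * j))) * tau k j A)
    = 1 / 2 ^ i * hahn_transform (int ?n) (tau_weight A k) i"
    unfolding hahn_transform_def sum_distrib_left atLeast0AtMost
    by (intro sum.cong refl T) simp
  then show ?thesis unfolding pi_val_def D by simp
qed

text \<open>
  The left-hand side is the coefficient in the Lefschetz decomposition times the double
  factorial \<open>(2n - 4i + 1)!!\<close> coming from \<open>\<pi>\<^bsub>k,i\<^esub>\<close>; the right-hand side is, up to sign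
  and a power of 2, the coefficient in \<open>hahn_inversion\<close>.
\<close>

lemma lefschetz_coefficient:
  fixes n i r :: nat
  assumes "i \<le> r" "i + r \<le> n"
  shows "of_nat ((n - 2 * i) choose (r - i)) * (fact (2 * n - 2 * i - 2 * r) / fact (2 * n - 4 * i))
      * odd_dfact (int n - 2 * int i + 1)
    = of_int (2 * int n - 4 * int i + 1) * odd_dfact (int n - int i - int r) / fact (r - i)
      * (2 ^ i / 2 ^ r :: 'a::field_char_0)"
proof -
  let ?D = "odd_dfact :: int \<Rightarrow> 'a"
  have 1: "fact (2 * n - 2 * i - 2 * r) = 2 ^ (n - i - r) * fact (n - i - r) * ?D (int n - int i - int r)"
  proof -
    have "2 * (n - i - r) = 2 * n - 2 * i - 2 * r" "int (n - i - r) = int n - int i - int r"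
      using assms by auto
    then show ?thesis using fact_split_odd(1)[of "n - i - r", where 'a = 'a] by metis
  qed
  have "2 * (n - 2 * i) = 2 * n - 4 * i" "int (n - 2 * i) = int n - 2 * int i" using assms by auto
  then have 2: "fact (2 * n - 4 * i) = 2 ^ (n - 2 * i) * fact (n - 2 * i) * ?D (int n - 2 * int i)"
    using fact_split_odd(1)[of "n - 2 * i", where 'a = 'a] by simp
  have 3: "of_nat ((n - 2 * i) choose (r - i)) = (fact (n - 2 * i) / (fact (r - i) * fact (n - i - r)) :: 'a)"
  proof -
    have "n - 2 * i - (r - i) = n - i - r" "r - i \<le> n - 2 * i" using assms by auto
    then show ?thesis by (metis binomial_fact)
  qed
  have 4: "?D (int n - 2 * int i + 1) = of_int (2 * int n - 4 * int i + 1) * ?D (int n - 2 * int i)"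
    by (subst odd_dfact_step) simp
  have "2 ^ r * 2 ^ (n - i - r) = (2 ^ i * 2 ^ (n - 2 * i) :: 'a)"
    unfolding power_add[symmetric] using assms by (intro arg_cong[where f = "\<lambda>e. 2 ^ e"]) simp
  then have 5: "2 ^ (n - i - r) = (2 ^ i / 2 ^ r * 2 ^ (n - 2 * i) :: 'a)"
    by (simp add: field_simps)
  show ?thesis unfolding 1 2 3 4 5
    using odd_dfact_ne_0[of "int n - 2 * int i", where 'a = 'a] by (simp del: of_int_diff of_int_add of_int_mult)
qed

theorem proposition3p5:
  fixes A :: "(complex ^ 'n::finite) set" and k r :: nat
  assumes "convex_body A"
    and "max 0 (int k - int CARD('n)) \<le> int r" and "2 * r \<le> k" and "k \<le> 2 * CARD('n)"
  shows "tau k r A =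
    1 / fact (k - 2 * r) *
    (\<Sum>i = 0..r.
       if k + 2 * i \<le> 2 * CARD('n)
       then of_nat ((CARD('n) - 2 * i) choose (r - i))
            * (fact (2 * CARD('n) - 2 * i - 2 * r) / fact (2 * CARD('n) - 4 * i))
            * pi_val k i A
       else 0)"
proof -
  let ?n = "CARD('n)"
  let ?B = "hahn_transform (int ?n) (tau_weight A k)"
  let ?S = "\<lambda>i. (-1) ^ i * of_int (2 * int ?n - 4 * int i + 1) *
     odd_dfact (int ?n - int i - int r) / fact (r - i) * ?B i"
  have summand: "(if k + 2 * i \<le> 2 * ?n
       then of_nat ((?n - 2 * i) choose (r - i))
            * (fact (2 * ?n - 2 * i - 2 * r) / fact (2 * ?n - 4 * i)) * pi_val k i A
       else 0) = 1 / 2 ^ r * ?S i" if "i \<le> r" for i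
  proof (cases "k + 2 * i \<le> 2 * ?n")
    case True
    then have "i + r \<le> ?n" "2 * i \<le> ?n" using that assms(3) by auto
    have "of_nat ((?n - 2 * i) choose (r - i))
            * (fact (2 * ?n - 2 * i - 2 * r) / fact (2 * ?n - 4 * i)) * pi_val k i A
      = (of_nat ((?n - 2 * i) choose (r - i))
            * (fact (2 * ?n - 2 * i - 2 * r) / fact (2 * ?n - 4 * i)) * odd_dfact (int ?n - 2 * int i + 1))
         * ((-1) ^ i / 2 ^ i * ?B i)"
      unfolding pi_val_hahn_transform[OF \<open>2 * i \<le> ?n\<close>]
      by (simp only: times_divide_eq_left times_divide_eq_right divide_divide_eq_left mult_ac)
    also have "\<dots> = 1 / 2 ^ r * ?S i"
      unfolding lefschetz_coefficient[OF that \<open>i + r \<le> ?n\<close>, where 'a = complex]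
      by (simp add: mult_ac del: of_int_diff of_int_add of_int_mult)
    finally show ?thesis using True by (simp only: if_True)
  next
    case False
    then have "?B i = 0" using that assms(3) by (intro hahn_transform_tau_vanishes) auto
    with False show ?thesis by simp
  qed
  have "(\<Sum>i = 0..r. if k + 2 * i \<le> 2 * ?n
       then of_nat ((?n - 2 * i) choose (r - i))
            * (fact (2 * ?n - 2 * i - 2 * r) / fact (2 * ?n - 4 * i)) * pi_val k i A
       else 0) = 1 / 2 ^ r * (\<Sum>i\<le>r. ?S i)"
    unfolding sum_distrib_left atLeast0AtMost by (intro sum.cong refl summand) simp
  also have "\<dots> = 1 / 2 ^ r * ((-1) ^ r * tau_weight A k r)"
    by (simp only: hahn_inversion)
  also have "\<dots> = fact (k - 2 * r) * tau k r A"
  proof -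
    have "(-1) ^ r * (-2) ^ r = (2 ^ r :: complex)" by (simp flip: power_mult_distrib)
    then show ?thesis unfolding tau_weight_def by (simp add: mult.assoc[symmetric])
  qed
  finally show ?thesis by simp
qed

end
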